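(* For every optimal prefix-free machine $V$, there exists an optimal prefix-free machine $W$ for which the following conditions (i) and (ii) hold: (i) $H_W(s)=H_V(s)$ for every $s\in\{0,1\}^*$. (ii) $W^{-1}(s)$ is an infinite set for every $s\in\{0,1\}^*$.
   Context: $\{0,1\}^*$ is the set of finite binary strings (including the empty string), and $|p|$ is the length of a string $p$. $\mathbb{N}=\{0,1,2,\dots\}$. $\operatorname{dom} f$ is the domain of definition of a (partial) function $f$. A subset of $\{0,1\}^*$ is prefix-free if no string in it is a prefix of another string in it. A prefix-free machine is a partial recursive function $C\colon\{0,1\}^*\to\{0,1\}^*$ such that $\operatorname{dom} C$ is a prefix-free set. For a prefix-free machine $C$ and $s\in\{0,1\}^*$, $C^{-1}(s)=\{\,p\in\operatorname{dom} C\mid C(p)=s\,\}$ and $H_C(s)=\min\{\,|p| \mid p\in\{0,1\}^*,\ C(p)=s\,\}$, with $H_C(s)=\infty$ if no such $p$ exists. A prefix-free machine $V$ is optimal if for each prefix-free machine $C$ there exists $d\in\mathbb{N}$ such that for every $p\in\operatorname{dom} C$ there is $q$ with $V(q)=C(p)$ and $|q|\le|p|+d$; equivalently, for each prefix-free machine $C$ there exists $d\in\mathbb{N}$ such that $H_V(s)\le H_C(s)+d$ for every $s\in\{0,1\}^*$. *)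

theory Defs
  imports Main "HOL-Library.Extended_Nat" "HOL-Library.Sublist"
begin

datatype recf =
    Zero
  | Succ
  | Proj nat
  | Comp recf "recf list"
  | PrimRec recf recf
  | Mu recf

inductive has_arity :: "recf \<Rightarrow> nat \<Rightarrow> bool" where
  arity_Zero: "has_arity Zero n"
| arity_Succ: "has_arity Succ 1"
| arity_Proj: "i < n \<Longrightarrow> has_arity (Proj i) n"
| arity_Comp: "has_arity f (length gs) \<Longrightarrow> (\<forall>g\<in>set gs. has_arity g n) \<Longrightarrow> has_arity (Comp f gs) n"
| arity_PrimRec: "has_arity f n \<Longrightarrow> has_arity g (n + 2) \<Longrightarrow> has_arity (PrimRec f g) (n + 1)"
| arity_Mu: "has_arity f (n + 1) \<Longrightarrow> has_arity (Mu f) n"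

text \<open>
  \<open>evaluates f xs y\<close> means that the partial function described by \<open>f\<close> is defined at the argument
  vector \<open>xs\<close> and has the value \<open>y\<close> there. The recursion variable and the variable of the
  minimisation come first in the argument vector. The minimisation is the partial one: all values
  before the zero that is found have to be defined.
\<close>

inductive evaluates :: "recf \<Rightarrow> nat list \<Rightarrow> nat \<Rightarrow> bool" where
  eval_Zero: "evaluates Zero xs 0"
| eval_Succ: "evaluates Succ [x] (Suc x)"
| eval_Proj: "i < length xs \<Longrightarrow> evaluates (Proj i) xs (xs ! i)"
| eval_Comp: "list_all2 (\<lambda>g y. evaluates g xs y) gs ys \<Longrightarrow> evaluates f ys z \<Longrightarrow>
    evaluates (Comp f gs) xs z"
| eval_PrimRec_0: "evaluates f xs y \<Longrightarrow> evaluates (PrimRec f g) (0 # xs) y"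
| eval_PrimRec_Suc: "evaluates (PrimRec f g) (n # xs) y \<Longrightarrow> evaluates g (n # y # xs) z \<Longrightarrow>
    evaluates (PrimRec f g) (Suc n # xs) z"
| eval_Mu: "evaluates f (n # xs) 0 \<Longrightarrow> (\<forall>m<n. \<exists>y>0. evaluates f (m # xs) y) \<Longrightarrow>
    evaluates (Mu f) xs n"

inductive_cases evaluates_ZeroE: "evaluates Zero xs y"
inductive_cases evaluates_SuccE: "evaluates Succ xs y"
inductive_cases evaluates_ProjE: "evaluates (Proj i) xs y"
inductive_cases evaluates_CompE: "evaluates (Comp f gs) xs y"
inductive_cases evaluates_PrimRec_0E: "evaluates (PrimRec f g) (0 # xs) y"
inductive_cases evaluates_PrimRec_SucE: "evaluates (PrimRec f g) (Suc n # xs) y"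
inductive_cases evaluates_MuE: "evaluates (Mu f) xs y"

lemma evaluates_deterministic:
  "evaluates f xs y \<Longrightarrow> evaluates f xs z \<Longrightarrow> y = z"
proof (induction arbitrary: z rule: evaluates.induct)
  case (eval_Zero xs)
  then show ?case by (elim evaluates_ZeroE) simp
next
  case (eval_Succ x)
  then show ?case by (elim evaluates_SuccE) simp
next
  case (eval_Proj i xs)
  from eval_Proj.prems show ?case by (elim evaluates_ProjE) simp
next
  case (eval_Comp xs gs ys f z')
  from eval_Comp.prems obtain zs
    where zs: "list_all2 (\<lambda>g y. evaluates g xs y) gs zs" "evaluates f zs z"
    by (elim evaluates_CompE)
  have "ys = zs"
    using eval_Comp.IH(1) zs(1)
    by (intro nth_equalityI) (auto simp: list_all2_conv_all_nth)
  with eval_Comp.IH(2) zs(2) show ?case by simp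
next
  case (eval_PrimRec_0 f xs y g)
  from eval_PrimRec_0.prems show ?case
    by (elim evaluates_PrimRec_0E) (rule eval_PrimRec_0.IH)
next
  case (eval_PrimRec_Suc f g n xs y z')
  from eval_PrimRec_Suc.prems obtain y'
    where "evaluates (PrimRec f g) (n # xs) y'" "evaluates g (n # y' # xs) z"
    by (elim evaluates_PrimRec_SucE)
  with eval_PrimRec_Suc.IH show ?case by metis
next
  case (eval_Mu f n xs)
  from eval_Mu.prems have z: "evaluates f (z # xs) 0" "\<forall>m<z. \<exists>y>0. evaluates f (m # xs) y"
    by (elim evaluates_MuE; simp)+
  show ?case
  proof (rule linorder_cases[of n z])
    assume "n < z"
    with z(2) eval_Mu.IH(1) show ?thesis by (metis less_irrefl)
  next
    assume "z < n"
    with z(1) eval_Mu.IH(2) show ?thesis by (metis less_irrefl)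
  qed
qed

text \<open>
  Strings are identified with natural numbers by bijective base-2 numeration, least significant
  digit first, \<open>False\<close> and \<open>True\<close> being the digits 1 and 2.
\<close>

primrec code :: "bool list \<Rightarrow> nat" where
  "code [] = 0"
| "code (b # bs) = 2 * code bs + (if b then 2 else 1)"

lemma bij_code: "bij code"
proof (rule bijI)
  show "inj code"
  proof (rule injI)
    show "xs = ys" if "code xs = code ys" for xs ys
      using that
    proof (induction xs arbitrary: ys)
      case Nil
      then show ?case by (cases ys) (auto split: if_splits)
    next
      case (Cons a xs)
      then obtain b ys' where ys: "ys = b # ys'" by (cases ys) (auto split: if_splits)
      have "a = b \<and> code xs = code ys'"
        using Cons.prems unfolding ys by (simp split: if_splits; presburger)
      with Cons.IH ys show ?case by blast
    qed
  qed
  have "\<exists>p. n = code p" for n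
  proof (induction n rule: less_induct)
    case (less n)
    show ?case
    proof (cases n)
      case 0
      then show ?thesis by (intro exI[of _ "[]"]) simp
    next
      case (Suc m)
      then have "m div 2 < n" by linarith
      then obtain p where p: "m div 2 = code p" using less.IH by blast
      have "n = code (odd m # p)"
        unfolding Suc code.simps p[symmetric] by (simp; presburger)
      then show ?thesis by blast
    qed
  qed
  then show "surj code" unfolding surj_def by blast
qed

definition partial_recursive :: "(bool list \<rightharpoonup> bool list) \<Rightarrow> bool" where
  "partial_recursive C \<longleftrightarrow>
     (\<exists>f. has_arity f 1 \<and> (\<forall>p s. C p = Some s \<longleftrightarrow> evaluates f [code p] (code s)))"

definition prefix_free :: "'a list set \<Rightarrow> bool" where
  "prefix_free S \<longleftrightarrow> (\<forall>p\<in>S. \<forall>q\<in>S. prefix p q \<longrightarrow> p = q)"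

definition prefix_free_machine :: "(bool list \<rightharpoonup> bool list) \<Rightarrow> bool" where
  "prefix_free_machine C \<longleftrightarrow> partial_recursive C \<and> prefix_free (dom C)"

text \<open>The infimum of a nonempty set of extended naturals is its minimum; \<open>Inf {} = \<infinity>\<close>.\<close>

definition complexity :: "(bool list \<rightharpoonup> bool list) \<Rightarrow> bool list \<Rightarrow> enat" where
  "complexity C s = Inf {enat (length p) | p. C p = Some s}"

definition optimal :: "(bool list \<rightharpoonup> bool list) \<Rightarrow> bool" where
  "optimal V \<longleftrightarrow> prefix_free_machine V \<and>
     (\<forall>C. prefix_free_machine C \<longrightarrow>
       (\<exists>d. \<forall>p\<in>dom C. \<exists>q. V q = C p \<and> length q \<le> length p + d))"

end

theory Submission
  imports Defs
begin

text \<open>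
  An optimal machine \<open>V\<close> cannot be injective: otherwise a computable search for a halting program
  \<open>g p\<close> at least twice as long as \<open>p\<close> would give, for the machine \<open>p \<mapsto> V (g p)\<close> on \<open>dom V\<close>, strings
  whose descriptions are all much longer than \<open>p\<close>. So some string has two programs, and the longer
  one, \<open>r\<close>, may be given up without changing any complexity. The cone above \<open>r\<close> then becomes free for
  infinitely many copies of \<open>V\<close>: let \<open>W p\<close> be \<open>V\<close> applied to \<open>p\<close> stripped of its leading copies
  of \<open>r\<close>. Running the search needs an effective enumeration of \<open>dom V\<close>; for one fixed program the
  step-bounded computations are found by recursion on the program, without a universal function.
\<close>

section \<open>Total recursive functions\<close>

text \<open>Arguments are lists, as in \<open>evaluates\<close>, and only lists of length
  \<open>n\<close> count. Thus \<open>F\<close> may be any HOL function written with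
  \<open>!\<close>, \<open>hd\<close> or \<open>tl\<close>, whatever it does on other lists.\<close>

definition total_rec :: "nat \<Rightarrow> (nat list \<Rightarrow> nat) \<Rightarrow> bool" where
  "total_rec n F \<longleftrightarrow> (\<exists>f. has_arity f n \<and> (\<forall>xs. length xs = n \<longrightarrow> evaluates f xs (F xs)))"

lemma total_recE:
  assumes "total_rec n F"
  obtains f where "has_arity f n" "\<And>xs y. length xs = n \<Longrightarrow> evaluates f xs y \<longleftrightarrow> y = F xs"
  using assms evaluates_deterministic unfolding total_rec_def by metis

lemma total_rec_cong:
  assumes "total_rec n F" "\<And>xs. length xs = n \<Longrightarrow> F xs = G xs"
  shows "total_rec n G"
  using assms unfolding total_rec_def by metis

lemma total_rec_nth: "i < n \<Longrightarrow> total_rec n (\<lambda>xs. xs ! i)"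
  unfolding total_rec_def by (intro exI[of _ "Proj i"]) (auto intro: arity_Proj eval_Proj)

text \<open>One program per component of \<open>G xs\<close> is fed to \<open>Comp\<close>. The
  vector is a single list-valued function because in \<open>stages_Comp\<close> the number of
  components depends on the program.\<close>

lemma total_rec_subst:
  assumes F: "total_rec k F"
    and G: "\<And>i. i < k \<Longrightarrow> total_rec n (\<lambda>xs. G xs ! i)"
    and len: "\<And>xs. length xs = n \<Longrightarrow> length (G xs) = k"
  shows "total_rec n (\<lambda>xs. F (G xs))"
proof -
  obtain f where f: "has_arity f k" "\<And>xs. length xs = k \<Longrightarrow> evaluates f xs (F xs)"
    using F unfolding total_rec_def by blast
  have "\<forall>i. \<exists>g. i < k \<longrightarrow> has_arity g n \<and> (\<forall>xs. length xs = n \<longrightarrow> evaluates g xs (G xs ! i))"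
    using G unfolding total_rec_def by blast
  then obtain g where g: "\<And>i. i < k \<Longrightarrow> has_arity (g i) n"
    "\<And>i xs. i < k \<Longrightarrow> length xs = n \<Longrightarrow> evaluates (g i) xs (G xs ! i)"
    by metis
  have "has_arity (Comp f (map g [0..<k])) n"
    using f g by (intro arity_Comp) auto
  moreover have "evaluates (Comp f (map g [0..<k])) xs (F (G xs))" if "length xs = n" for xs
    using f(2)[OF len[OF that]] g(2) len that
    by (intro eval_Comp[of _ _ "G xs"]) (auto simp: list_all2_conv_all_nth)
  ultimately show ?thesis unfolding total_rec_def by blast
qed

text \<open>Common source of the rules for changing argument vectors. Weakening, prefixing a
  computed argument and ordinary composition are instances.\<close>

lemma total_rec_args:
  assumes F: "total_rec (length As + m) F" and As: "\<forall>A\<in>set As. total_rec (d + m) A"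
  shows "total_rec (d + m) (\<lambda>xs. F (map (\<lambda>A. A xs) As @ drop d xs))"
proof (rule total_rec_subst[OF F])
  fix i assume i: "i < length As + m"
  show "total_rec (d + m) (\<lambda>xs. (map (\<lambda>A. A xs) As @ drop d xs) ! i)"
  proof (cases "i < length As")
    case True
    with As show ?thesis by (simp add: nth_append)
  next
    case False
    then have "total_rec (d + m) (\<lambda>xs. xs ! (d + (i - length As)))"
      using i by (intro total_rec_nth) simp
    then show ?thesis by (rule total_rec_cong) (use False i in \<open>simp add: nth_append\<close>)
  qed
qed auto

lemma total_rec_comp1:
  assumes "total_rec 1 (\<lambda>xs. h (xs ! 0))" "total_rec n A"
  shows "total_rec n (\<lambda>xs. h (A xs))"
  using total_rec_args[of "[A]" 0 "\<lambda>xs. h (xs ! 0)" n] assms by simp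

lemma total_rec_comp2:
  assumes "total_rec 2 (\<lambda>xs. h (xs ! 0) (xs ! 1))" "total_rec n A" "total_rec n B"
  shows "total_rec n (\<lambda>xs. h (A xs) (B xs))"
  using total_rec_args[of "[A, B]" 0 "\<lambda>xs. h (xs ! 0) (xs ! 1)" n] assms by (auto simp: numeral_2_eq_2)

lemma total_rec_Suc:
  assumes "total_rec n A"
  shows "total_rec n (\<lambda>xs. Suc (A xs))"
proof (rule total_rec_comp1[OF _ assms])
  show "total_rec 1 (\<lambda>xs. Suc (xs ! 0))"
    unfolding total_rec_def using arity_Succ eval_Succ
    by (intro exI[of _ Succ]) (auto simp: length_Suc_conv)
qed

lemma total_rec_const: "total_rec n (\<lambda>_. c)"
proof (induction c)
  case 0
  then show ?case unfolding total_rec_def using arity_Zero eval_Zero by blast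
qed (rule total_rec_Suc)

lemma total_rec_weaken:
  assumes "total_rec n F"
  shows "total_rec (Suc n) (\<lambda>xs. F (tl xs))"
  using total_rec_args[of "[]" n F 1] assms by (simp add: drop_Suc)

lemma total_rec_Cons:
  assumes "total_rec (Suc n) F" "total_rec n A"
  shows "total_rec n (\<lambda>xs. F (A xs # xs))"
  using total_rec_args[of "[A]" n F 0] assms by simp

lemma total_rec_primrec:
  assumes "total_rec n A" "total_rec n F" "total_rec (Suc (Suc n)) G"
  shows "total_rec n (\<lambda>xs. rec_nat (F xs) (\<lambda>k y. G (k # y # xs)) (A xs))"
proof -
  obtain f where f: "has_arity f n" "\<And>xs. length xs = n \<Longrightarrow> evaluates f xs (F xs)"
    using assms(2) unfolding total_rec_def by blast
  obtain g where g: "has_arity g (Suc (Suc n))"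
    "\<And>xs. length xs = Suc (Suc n) \<Longrightarrow> evaluates g xs (G xs)"
    using assms(3) unfolding total_rec_def by blast
  let ?R = "\<lambda>xs. rec_nat (F (tl xs)) (\<lambda>k y. G (k # y # tl xs)) (hd xs)"
  have "evaluates (PrimRec f g) (m # xs) (?R (m # xs))" if "length xs = n" for m xs
  proof (induction m)
    case 0
    then show ?case using f that by (auto intro: eval_PrimRec_0)
  next
    case (Suc m)
    then show ?case using g(2) that by (auto intro!: eval_PrimRec_Suc)
  qed
  moreover have "has_arity (PrimRec f g) (Suc n)"
    using arity_PrimRec[OF f(1)] g(1) by simp
  ultimately have "total_rec (Suc n) ?R"
    unfolding total_rec_def by (intro exI[of _ "PrimRec f g"]) (auto simp: length_Suc_conv)
  from total_rec_Cons[OF this assms(1)] show ?thesis by simp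
qed

lemma total_rec_funpow:
  assumes s: "total_rec 1 (\<lambda>xs. s (xs ! 0))" and A: "total_rec n A" and B: "total_rec n B"
  shows "total_rec n (\<lambda>xs. (s ^^ A xs) (B xs))"
proof -
  have "rec_nat b (\<lambda>k y. s y) a = (s ^^ a) b" for a b
    by (induction a) auto
  moreover have "total_rec (Suc (Suc n)) (\<lambda>zs. s (zs ! 1))"
    by (intro total_rec_comp1[OF s] total_rec_nth) simp
  ultimately show ?thesis using total_rec_primrec[OF A B, of "\<lambda>zs. s (zs ! 1)"] by simp
qed

lemma total_rec_add:
  assumes "total_rec n A" "total_rec n B"
  shows "total_rec n (\<lambda>xs. A xs + B xs)"
  using total_rec_funpow[OF total_rec_Suc[OF total_rec_nth] assms] by simp

lemma total_rec_mult:
  assumes "total_rec n A" "total_rec n B"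
  shows "total_rec n (\<lambda>xs. A xs * B xs)"
proof (rule total_rec_comp2[OF _ assms])
  have *: "rec_nat 0 (\<lambda>k y. y + b) a = a * b" for a b :: nat
    by (induction a) auto
  show "total_rec 2 (\<lambda>xs. xs ! 0 * xs ! 1)"
    \<comment> \<open>Here \<open>zs\<close> consists of the counter, the running product and the
      two factors, so the second factor is added once per round.\<close>
    using total_rec_primrec[of 2 "\<lambda>xs. xs ! 0" "\<lambda>_. 0" "\<lambda>zs. zs ! 1 + zs ! 3"]
    by (simp add: * total_rec_nth total_rec_const total_rec_add)
qed

lemma total_rec_pred:
  assumes "total_rec n A"
  shows "total_rec n (\<lambda>xs. A xs - 1)"
proof -
  have "rec_nat 0 (\<lambda>k y. k) a = a - 1" for a by (cases a) auto
  then show ?thesis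
    using total_rec_primrec[OF assms total_rec_const[of n 0] total_rec_nth[of 0 "Suc (Suc n)"]] by simp
qed

lemma total_rec_diff:
  assumes "total_rec n A" "total_rec n B"
  shows "total_rec n (\<lambda>xs. A xs - B xs)"
proof -
  have "((\<lambda>x. x - 1) ^^ b) a = a - b" for a b :: nat
    by (induction b) auto
  then show ?thesis
    using total_rec_funpow[OF total_rec_pred[OF total_rec_nth] assms(2,1)] by simp
qed

section \<open>Decidable predicates, definition by cases and minimisation\<close>

text \<open>Truth is coded by 0, so that \<open>Mu\<close> searches for a true instance; moreover
  truncated subtraction then decides \<open>\<le>\<close> and addition gives conjunction.\<close>

definition decidable :: "nat \<Rightarrow> (nat list \<Rightarrow> bool) \<Rightarrow> bool" where
  "decidable n P \<longleftrightarrow> (\<exists>F. total_rec n F \<and> (\<forall>xs. length xs = n \<longrightarrow> (P xs \<longleftrightarrow> F xs = 0)))"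

lemma decidable_le:
  assumes "total_rec n A" "total_rec n B"
  shows "decidable n (\<lambda>xs. A xs \<le> B xs)"
  unfolding decidable_def using total_rec_diff[OF assms] by force

lemma decidable_conj:
  assumes "decidable n P" "decidable n Q"
  shows "decidable n (\<lambda>xs. P xs \<and> Q xs)"
proof -
  obtain F G where "total_rec n F" "\<forall>xs. length xs = n \<longrightarrow> (P xs \<longleftrightarrow> F xs = 0)"
    "total_rec n G" "\<forall>xs. length xs = n \<longrightarrow> (Q xs \<longleftrightarrow> G xs = 0)"
    using assms unfolding decidable_def by blast
  then show ?thesis
    unfolding decidable_def by (intro exI[of _ "\<lambda>xs. F xs + G xs"]) (simp add: total_rec_add)
qed

lemma decidable_not:
  assumes "decidable n P"
  shows "decidable n (\<lambda>xs. \<not> P xs)"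
proof -
  obtain F where "total_rec n F" "\<forall>xs. length xs = n \<longrightarrow> (P xs \<longleftrightarrow> F xs = 0)"
    using assms unfolding decidable_def by blast
  then show ?thesis
    unfolding decidable_def
    by (intro exI[of _ "\<lambda>xs. 1 - F xs"]) (auto intro: total_rec_diff total_rec_const)
qed

lemma decidable_disj:
  assumes "decidable n P" "decidable n Q"
  shows "decidable n (\<lambda>xs. P xs \<or> Q xs)"
  using decidable_not[OF decidable_conj[OF decidable_not[OF assms(1)] decidable_not[OF assms(2)]]]
  by simp

lemma decidable_eq:
  assumes "total_rec n A" "total_rec n B"
  shows "decidable n (\<lambda>xs. A xs = B xs)"
  unfolding eq_iff using assms by (intro decidable_conj decidable_le)

text \<open>The bound \<open>k\<close> is a fixed number and not an argument of the recursive
  function, so a finite disjunction built by induction on \<open>k\<close> suffices.\<close>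

lemma decidable_bex:
  assumes "\<And>i. i < k \<Longrightarrow> decidable n (P i)"
  shows "decidable n (\<lambda>xs. \<exists>i<(k::nat). P i xs)"
  using assms
proof (induction k)
  case 0
  then show ?case
    using decidable_eq[OF total_rec_const[of n 0] total_rec_const[of n 1]] by simp
next
  case (Suc k)
  then have "decidable n (\<lambda>xs. P k xs \<or> (\<exists>i<k. P i xs))"
    by (intro decidable_disj) auto
  then show ?case by (simp add: Ex_less_Suc)
qed

lemma total_rec_if:
  assumes P: "decidable n P" and "total_rec n A" "total_rec n B"
  shows "total_rec n (\<lambda>xs. if P xs then A xs else B xs)"
proof -
  obtain F where F: "total_rec n F" "\<forall>xs. length xs = n \<longrightarrow> (P xs \<longleftrightarrow> F xs = 0)"
    using P unfolding decidable_def by blast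
  \<comment> \<open>By truncated subtraction \<open>1 - F xs\<close> is 1 where \<open>P\<close>
    holds and 0 elsewhere; the other factor is its complement.\<close>
  have "total_rec n (\<lambda>xs. (1 - F xs) * A xs + (1 - (1 - F xs)) * B xs)"
    by (intro total_rec_add total_rec_mult total_rec_diff total_rec_const F assms)
  then show ?thesis by (rule total_rec_cong) (use F in auto)
qed

text \<open>The test for \<open>P\<close> is total, so all values that \<open>Mu\<close> meets on
  the way are defined; the hypothesis \<open>ex\<close> makes the search halt.\<close>

lemma total_rec_Least:
  assumes P: "decidable (Suc n) P" and ex: "\<And>xs. length xs = n \<Longrightarrow> \<exists>m. P (m # xs)"
  shows "total_rec n (\<lambda>xs. LEAST m. P (m # xs))"
proof -
  obtain F where "total_rec (Suc n) F" and PF: "\<forall>xs. length xs = Suc n \<longrightarrow> (P xs \<longleftrightarrow> F xs = 0)"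
    using P unfolding decidable_def by blast
  then obtain f where f: "has_arity f (Suc n)"
    "\<And>xs. length xs = Suc n \<Longrightarrow> evaluates f xs (F xs)"
    unfolding total_rec_def by blast
  have "evaluates (Mu f) xs (LEAST m. P (m # xs))" if xs: "length xs = n" for xs
  proof (rule eval_Mu)
    have "F ((LEAST m. P (m # xs)) # xs) = 0"
      using LeastI_ex[OF ex[OF xs]] PF xs by simp
    then show "evaluates f ((LEAST m. P (m # xs)) # xs) 0"
      using f(2)[of "(LEAST m. P (m # xs)) # xs"] xs by simp
    show "\<forall>m<LEAST m. P (m # xs). \<exists>y>0. evaluates f (m # xs) y"
      using f(2) PF xs not_less_Least by (metis length_Cons neq0_conv)
  qed
  moreover have "has_arity (Mu f) n" using f(1) arity_Mu by simp
  ultimately show ?thesis unfolding total_rec_def by blast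
qed

section \<open>Computation stages\<close>

text \<open>\<open>F (t # xs)\<close> is \<open>Suc y\<close> if \<open>f\<close> is seen to have the value \<open>y\<close> at \<open>xs\<close> by stage \<open>t\<close>,
  and 0 if no value has been seen yet.\<close>

definition stages :: "nat \<Rightarrow> recf \<Rightarrow> (nat list \<Rightarrow> nat) \<Rightarrow> bool" where
  "stages n f F \<longleftrightarrow> total_rec (Suc n) F \<and>
     (\<forall>xs s t y. length xs = n \<longrightarrow> s \<le> t \<longrightarrow> F (s # xs) = Suc y \<longrightarrow> F (t # xs) = Suc y) \<and>
     (\<forall>xs y. length xs = n \<longrightarrow> (evaluates f xs y \<longleftrightarrow> (\<exists>t. F (t # xs) = Suc y)))"

lemma stages_mono:
  "stages n f F \<Longrightarrow> length xs = n \<Longrightarrow> s \<le> t \<Longrightarrow> F (s # xs) = Suc y \<Longrightarrow> F (t # xs) = Suc y"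
  unfolding stages_def by blast

lemma stages_evaluates:
  "stages n f F \<Longrightarrow> length xs = n \<Longrightarrow> evaluates f xs y \<longleftrightarrow> (\<exists>t. F (t # xs) = Suc y)"
  unfolding stages_def by blast

text \<open>A total recursive function can be reported as seen at every stage, so the stage is just
  dropped by \<open>tl\<close>.\<close>

lemma stages_total:
  assumes "\<And>xs y. length xs = n \<Longrightarrow> evaluates f xs y \<longleftrightarrow> y = G xs" "total_rec n G"
  shows "\<exists>F. stages n f F"
  unfolding stages_def using assms
  by (intro exI[of _ "\<lambda>ys. Suc (G (tl ys))"]) (auto intro: total_rec_Suc total_rec_weaken)

text \<open>The inner programs and the outer one are all run to the same stage. Monotonicity in the
  stage allows finitely many witnesses to be merged into one.\<close>

lemma stages_Comp:
  assumes f: "stages (length gs) f F"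
    and g: "\<And>i. i < length gs \<Longrightarrow> stages n (gs ! i) (G i)"
  shows "\<exists>H. stages n (Comp f gs) H"
proof
  let ?k = "length gs"
  define args where "args ys = map (\<lambda>i. G i ys - 1) [0..<?k]" for ys
  define H where "H ys = (if \<exists>i<?k. G i ys = 0 then 0 else F (hd ys # args ys))" for ys
  have H_Suc: "H (t # xs) = Suc z \<longleftrightarrow>
      (\<exists>ys. length ys = ?k \<and> (\<forall>i<?k. G i (t # xs) = Suc (ys ! i)) \<and> F (t # ys) = Suc z)"
    (is "_ \<longleftrightarrow> (\<exists>ys. ?R ys)") for t xs z
  proof
    assume *: "H (t # xs) = Suc z"
    then have "\<forall>i<?k. G i (t # xs) \<noteq> 0" unfolding H_def by (auto split: if_splits)
    with * have "?R (args (t # xs))" unfolding H_def args_def by (auto split: if_splits)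
    then show "\<exists>ys. ?R ys" by blast
  next
    assume "\<exists>ys. ?R ys"
    then obtain ys where ys: "?R ys" by blast
    then have "args (t # xs) = ys" by (intro nth_equalityI) (auto simp: args_def)
    with ys show "H (t # xs) = Suc z" unfolding H_def by auto
  qed
  show "stages n (Comp f gs) H"
    unfolding stages_def
  proof (intro conjI allI impI)
    have "total_rec (Suc n) (\<lambda>ys. F (hd ys # args ys))"
    proof (rule total_rec_subst[where G = "\<lambda>ys. hd ys # args ys" and k = "Suc ?k"])
      show "total_rec (Suc ?k) F" using f unfolding stages_def by blast
    next
      fix i assume i: "i < Suc ?k"
      show "total_rec (Suc n) (\<lambda>ys. (hd ys # args ys) ! i)"
      proof (cases i)
        case 0
        have "total_rec (Suc n) (\<lambda>ys. ys ! 0)" by (simp add: total_rec_nth)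
        then show ?thesis by (rule total_rec_cong) (auto simp: 0 length_Suc_conv)
      next
        case (Suc j)
        then show ?thesis
          using i g[of j] by (simp add: args_def stages_def total_rec_pred[unfolded One_nat_def])
      qed
    qed (simp add: args_def)
    then show "total_rec (Suc n) H"
      unfolding H_def using g unfolding stages_def
      by (intro total_rec_if decidable_bex decidable_eq total_rec_const) blast+
  next
    fix xs :: "nat list" and s t y assume xs: "length xs = n" "s \<le> t" "H (s # xs) = Suc y"
    then show "H (t # xs) = Suc y"
      unfolding H_Suc using stages_mono[OF f] stages_mono[OF g] by metis
  next
    fix xs :: "nat list" and y assume xs: "length xs = n"
    show "evaluates (Comp f gs) xs y \<longleftrightarrow> (\<exists>t. H (t # xs) = Suc y)"
    proof
      assume "evaluates (Comp f gs) xs y"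
      then obtain ys where ys: "list_all2 (\<lambda>g y. evaluates g xs y) gs ys" "evaluates f ys y"
        by (elim evaluates_CompE)
      then have len: "length ys = ?k" by (simp add: list_all2_lengthD)
      have "\<forall>i<?k. \<exists>t. G i (t # xs) = Suc (ys ! i)"
        using ys(1) stages_evaluates[OF g xs] by (auto simp: list_all2_conv_all_nth)
      then obtain T where T: "\<And>i. i < ?k \<Longrightarrow> G i (T i # xs) = Suc (ys ! i)" by metis
      obtain t where t: "F (t # ys) = Suc y"
        using ys(2) stages_evaluates[OF f len] by blast
      \<comment> \<open>The sum is a convenient stage above all the individual ones.\<close>
      define u where "u = t + (\<Sum>i<?k. T i)"
      have "T i \<le> u" if "i < ?k" for i
        using member_le_sum[of i "{..<?k}" T] that unfolding u_def by simp
      then have "\<forall>i<?k. G i (u # xs) = Suc (ys ! i)"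
        using stages_mono[OF g xs] T by blast
      moreover have "F (u # ys) = Suc y"
        using stages_mono[OF f len _ t, of u] unfolding u_def by simp
      ultimately show "\<exists>t. H (t # xs) = Suc y" unfolding H_Suc using len by blast
    next
      assume "\<exists>t. H (t # xs) = Suc y"
      then obtain t ys where "length ys = ?k" "\<forall>i<?k. G i (t # xs) = Suc (ys ! i)"
        "F (t # ys) = Suc y"
        unfolding H_Suc by blast
      then show "evaluates (Comp f gs) xs y"
        using stages_evaluates[OF f] stages_evaluates[OF g xs]
        by (intro eval_Comp[of _ _ ys]) (auto simp: list_all2_conv_all_nth)
    qed
  qed
qed

text \<open>For a fixed stage \<open>t\<close> the recursion becomes total: every unfolding is run
  to stage \<open>t\<close>, and the value 0 for an unseen result is passed on to all later
  unfoldings.\<close>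

lemma stages_PrimRec:
  assumes f: "stages n f F" and g: "stages (n + 2) g G"
  shows "\<exists>H. stages (n + 1) (PrimRec f g) H"
proof
  define R where "R t xs k =
    rec_nat (F (t # xs)) (\<lambda>k y. if y = 0 then 0 else G (t # k # (y - 1) # xs)) k" for t xs k
  define H where "H ys = R (ys ! 0) (tl (tl ys)) (ys ! 1)" for ys
  have H_Cons: "H (t # k # xs) = R t xs k" for t k xs by (simp add: H_def)
  have R_0: "R t xs 0 = F (t # xs)" for t xs by (simp add: R_def)
  have R_Suc: "R t xs (Suc k) = (if R t xs k = 0 then 0 else G (t # k # (R t xs k - 1) # xs))"
    for t xs k by (simp add: R_def)
  have mono: "R t xs k = Suc y" if "length xs = n" "s \<le> t" "R s xs k = Suc y" for xs s t k y
    using that(3)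
  proof (induction k arbitrary: y)
    case 0
    then show ?case using stages_mono[OF f that(1,2)] by (simp add: R_0)
  next
    case (Suc k)
    then obtain z where z: "R s xs k = Suc z" by (cases "R s xs k") (auto simp: R_Suc)
    show ?case
      using Suc.IH[OF z] Suc.prems z stages_mono[OF g _ that(2), of "k # z # xs"] that(1)
      by (simp add: R_Suc)
  qed
  have ev: "evaluates (PrimRec f g) (k # xs) y \<longleftrightarrow> (\<exists>t. R t xs k = Suc y)"
    if xs: "length xs = n" for k xs y
  proof (induction k arbitrary: y)
    case 0
    show ?case
      unfolding R_0 stages_evaluates[OF f xs, symmetric]
      by (auto intro: eval_PrimRec_0 elim: evaluates_PrimRec_0E)
  next
    case (Suc k)
    have evg: "evaluates g (k # z # xs) y \<longleftrightarrow> (\<exists>t. G (t # k # z # xs) = Suc y)" for z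
      using stages_evaluates[OF g] xs by simp
    show ?case
    proof
      assume "evaluates (PrimRec f g) (Suc k # xs) y"
      then obtain z where "evaluates (PrimRec f g) (k # xs) z" "evaluates g (k # z # xs) y"
        by (elim evaluates_PrimRec_SucE)
      then obtain t u where tu: "R t xs k = Suc z" "G (u # k # z # xs) = Suc y"
        using Suc.IH evg by blast
      have "R (max t u) xs k = Suc z" using mono[OF xs _ tu(1)] by simp
      moreover have "G (max t u # k # z # xs) = Suc y"
        using stages_mono[OF g _ _ tu(2)] xs by simp
      ultimately show "\<exists>t. R t xs (Suc k) = Suc y"
        by (intro exI[of _ "max t u"]) (simp add: R_Suc)
    next
      assume "\<exists>t. R t xs (Suc k) = Suc y"
      then obtain t where t: "R t xs (Suc k) = Suc y" by blast
      then obtain z where z: "R t xs k = Suc z" by (cases "R t xs k") (auto simp: R_Suc)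
      with t have "G (t # k # z # xs) = Suc y" by (simp add: R_Suc)
      with z show "evaluates (PrimRec f g) (Suc k # xs) y"
        using Suc.IH evg by (blast intro: eval_PrimRec_Suc)
    qed
  qed
  show "stages (n + 1) (PrimRec f g) H"
    unfolding stages_def
  proof (intro conjI allI impI)
    have F': "total_rec (2 + n) (\<lambda>ys. F (ys ! 0 # drop 2 ys))"
      using total_rec_args[of "[\<lambda>ys. ys ! 0]" n F 2] f
      by (simp add: stages_def total_rec_nth)
    \<comment> \<open>In the recursion step \<open>zs\<close> holds the counter, the previous value,
      the stage, the recursion argument and then the parameters, in this order.\<close>
    have "total_rec (4 + n) (\<lambda>zs. G (zs ! 2 # zs ! 0 # (zs ! 1 - 1) # drop 4 zs))"
      using total_rec_args[of "[\<lambda>zs. zs ! 2, \<lambda>zs. zs ! 0, \<lambda>zs. zs ! 1 - 1]" n G 4] g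
      by (simp add: stages_def numeral_3_eq_3 total_rec_nth total_rec_pred[unfolded One_nat_def])
    then have "total_rec (4 + n)
        (\<lambda>zs. if zs ! 1 = 0 then 0 else G (zs ! 2 # zs ! 0 # (zs ! 1 - 1) # drop 4 zs))"
      by (intro total_rec_if decidable_eq total_rec_nth total_rec_const) auto
    moreover have "4 + n = Suc (Suc (2 + n))" by simp
    ultimately have "total_rec (Suc (Suc (2 + n)))
        (\<lambda>zs. if zs ! 1 = 0 then 0 else G (zs ! 2 # zs ! 0 # (zs ! 1 - 1) # drop 4 zs))"
      by metis
    from total_rec_primrec[OF total_rec_nth[of 1 "2 + n"] F' this]
    show "total_rec (Suc (n + 1)) H"
      by (simp add: H_def[abs_def] R_def drop_Suc numeral_eq_Suc cong: if_cong)
  next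
    fix xs :: "nat list" and s t y assume "length xs = n + 1" "s \<le> t" "H (s # xs) = Suc y"
    then show "H (t # xs) = Suc y" using mono by (auto simp: length_Suc_conv H_Cons)
  next
    fix xs :: "nat list" and y assume "length xs = n + 1"
    then show "evaluates (PrimRec f g) xs y \<longleftrightarrow> (\<exists>t. H (t # xs) = Suc y)"
      using ev by (auto simp: length_Suc_conv H_Cons)
  qed
qed

text \<open>At stage \<open>t\<close> the candidates up to \<open>t\<close> are examined. A result
  is output only if the first candidate without a visible positive value visibly has the value 0;
  otherwise a smaller zero might still turn up later.\<close>

lemma stages_Mu:
  assumes f: "stages (n + 1) f F"
  shows "\<exists>H. stages n (Mu f) H"
proof
  text \<open>Values 0 and 1 of \<open>F\<close> mean that no value, respectively the value 0, has been seen;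
    the alternative \<open>m = hd ys\<close> makes the search total.\<close>
  define M where "M ys = (LEAST m. F (hd ys # m # tl ys) \<le> 1 \<or> m = hd ys)" for ys
  define H where "H ys = (if F (hd ys # M ys # tl ys) = 1 then Suc (M ys) else 0)" for ys
  have F_rec: "total_rec (Suc (Suc n)) F" using f unfolding stages_def by simp
  have M: "total_rec (Suc n) M"
  proof -
    have "total_rec (2 + n) (\<lambda>zs. F (zs ! 1 # zs ! 0 # drop 2 zs))"
      using total_rec_args[of "[\<lambda>zs. zs ! 1, \<lambda>zs. zs ! 0]" n F 2] F_rec
      by (auto intro: total_rec_nth)
    then have "decidable (2 + n) (\<lambda>zs. F (zs ! 1 # zs ! 0 # drop 2 zs) \<le> 1 \<or> zs ! 0 = zs ! 1)"
      by (intro decidable_disj decidable_le decidable_eq total_rec_nth total_rec_const) auto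
    then have "total_rec (Suc n) (\<lambda>ys. LEAST m. (\<lambda>zs. F (zs ! 1 # zs ! 0 # drop 2 zs) \<le> 1 \<or>
        zs ! 0 = zs ! 1) (m # ys))"
      by (intro total_rec_Least) auto
    then show ?thesis
      by (rule total_rec_cong) (auto simp: M_def length_Suc_conv)
  qed
  \<comment> \<open>All three conditions persist when \<open>t\<close> grows, which yields
    monotonicity; the last one comes from the cutoff of the search at \<open>t\<close>.\<close>
  have H_Suc: "H (t # xs) = Suc m \<longleftrightarrow> F (t # m # xs) = 1 \<and> (\<forall>i<m. F (t # i # xs) > 1) \<and> m \<le> t"
    (is "_ \<longleftrightarrow> ?R") if xs: "length xs = n" for t xs m
  proof -
    let ?P = "\<lambda>m. F (t # m # xs) \<le> 1 \<or> m = t"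
    have M_eq: "M (t # xs) = (LEAST m. ?P m)" by (simp add: M_def)
    have M_P: "?P (M (t # xs))" unfolding M_eq by (rule LeastI[of ?P t]) simp
    have M_less: "\<not> ?P i" if "i < M (t # xs)" for i
      using that unfolding M_eq by (rule not_less_Least)
    have M_le: "M (t # xs) \<le> t" unfolding M_eq by (rule Least_le) simp
    show ?thesis
    proof
      assume "H (t # xs) = Suc m"
      then have "M (t # xs) = m" "F (t # m # xs) = 1"
        unfolding H_def by (auto split: if_splits)
      then show ?R using M_less M_le by (auto simp: not_le)
    next
      assume R: ?R
      have "M (t # xs) = m"
        unfolding M_eq
      proof (rule Least_equality)
        fix i assume "?P i"
        with R show "m \<le> i" by (metis leD leI)
      qed (use R in simp)
      with R show "H (t # xs) = Suc m" unfolding H_def by simp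
    qed
  qed
  have mono: "F (t # m # xs) = Suc y" if "length xs = n" "s \<le> t" "F (s # m # xs) = Suc y"
    for s t m xs y
    using stages_mono[OF f _ that(2), of "m # xs"] that by simp
  have ev: "evaluates f (m # xs) y \<longleftrightarrow> (\<exists>t. F (t # m # xs) = Suc y)" if "length xs = n" for m xs y
    using stages_evaluates[OF f] that by simp
  show "stages n (Mu f) H"
    unfolding stages_def
  proof (intro conjI allI impI)
    have "total_rec (Suc n) (\<lambda>ys. F (ys ! 0 # M ys # drop 1 ys))"
      using total_rec_args[of "[\<lambda>ys. ys ! 0, M]" n F 1] F_rec M
      by (auto intro: total_rec_nth)
    then have "total_rec (Suc n) (\<lambda>ys. F (hd ys # M ys # tl ys))"
      by (rule total_rec_cong) (auto simp: length_Suc_conv)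
    then show "total_rec (Suc n) H"
      unfolding H_def by (intro total_rec_if decidable_eq total_rec_const total_rec_Suc M)
  next
    fix xs :: "nat list" and s t y assume xs: "length xs = n" and st: "s \<le> t" and "H (s # xs) = Suc y"
    then have H: "F (s # y # xs) = 1" "\<forall>i<y. F (s # i # xs) > 1" "y \<le> s"
      using H_Suc by auto
    have "F (t # i # xs) > 1" if "i < y" for i
    proof -
      obtain z where "F (s # i # xs) = Suc z" "z > 0"
        using H(2) \<open>i < y\<close> by (cases "F (s # i # xs)") auto
      then show ?thesis using mono[OF xs st] by simp
    qed
    then show "H (t # xs) = Suc y"
      using H mono[OF xs st, of y 0] H_Suc[OF xs] st by auto
  next
    fix xs :: "nat list" and y assume xs: "length xs = n"
    show "evaluates (Mu f) xs y \<longleftrightarrow> (\<exists>t. H (t # xs) = Suc y)"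
    proof
      assume "evaluates (Mu f) xs y"
      then have y: "evaluates f (y # xs) 0" "\<forall>m<y. \<exists>z>0. evaluates f (m # xs) z"
        by (elim evaluates_MuE; simp)+
      obtain t where t: "F (t # y # xs) = Suc 0" using y(1) ev[OF xs] by blast
      have "\<forall>m. \<exists>u z. m < y \<longrightarrow> z > 0 \<and> F (u # m # xs) = Suc z"
        using y(2) ev[OF xs] by meson
      then obtain U Z where UZ: "\<And>m. m < y \<Longrightarrow> Z m > 0 \<and> F (U m # m # xs) = Suc (Z m)"
        by metis
      \<comment> \<open>This stage is at least \<open>y\<close>, so that the cutoff does not hide
        \<open>y\<close>, and late enough for the zero at \<open>y\<close> and the positive values
        below \<open>y\<close> to be seen.\<close>
      define T where "T = y + t + (\<Sum>m<y. U m)"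
      have "F (T # m # xs) > 1" if "m < y" for m
      proof -
        have "U m \<le> T" using member_le_sum[of m "{..<y}" U] that unfolding T_def by simp
        then show ?thesis using UZ[OF that] mono[OF xs, of "U m" T m "Z m"] by simp
      qed
      moreover have "F (T # y # xs) = Suc 0" using mono[OF xs _ t, of T] unfolding T_def by simp
      ultimately show "\<exists>t. H (t # xs) = Suc y"
        using H_Suc[OF xs] unfolding T_def by auto
    next
      assume "\<exists>t. H (t # xs) = Suc y"
      then obtain t where t: "F (t # y # xs) = 1" "\<forall>i<y. F (t # i # xs) > 1"
        using H_Suc[OF xs] by blast
      show "evaluates (Mu f) xs y"
      proof (rule eval_Mu)
        show "evaluates f (y # xs) 0" using t(1) ev[OF xs] by auto
        show "\<forall>m<y. \<exists>z>0. evaluates f (m # xs) z"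
        proof (intro allI impI)
          fix m assume "m < y"
          then obtain z where "F (t # m # xs) = Suc z" "z > 0"
            using t(2) by (cases "F (t # m # xs)") auto
          then show "\<exists>z>0. evaluates f (m # xs) z" using ev[OF xs] by blast
        qed
      qed
    qed
  qed
qed

lemma stages_exist: "has_arity f n \<Longrightarrow> \<exists>F. stages n f F"
proof (induction rule: has_arity.induct)
  case (arity_Zero n)
  show ?case
    by (intro stages_total[of _ _ "\<lambda>_. 0"] total_rec_const)
      (auto intro: eval_Zero elim: evaluates_ZeroE)
next
  case arity_Succ
  show ?case
    by (intro stages_total[of _ _ "\<lambda>xs. Suc (xs ! 0)"] total_rec_Suc total_rec_nth)
      (auto simp: length_Suc_conv intro: eval_Succ elim: evaluates_SuccE)
next
  case (arity_Proj i n)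
  then show ?case
    by (intro stages_total[of _ _ "\<lambda>xs. xs ! i"] total_rec_nth)
      (auto intro: eval_Proj elim: evaluates_ProjE)
next
  case (arity_Comp f gs n)
  then have "\<forall>i. \<exists>G. i < length gs \<longrightarrow> stages n (gs ! i) G" by auto
  then obtain G where "\<And>i. i < length gs \<Longrightarrow> stages n (gs ! i) (G i)" by metis
  with arity_Comp.IH(1) show ?case using stages_Comp by blast
next
  case (arity_PrimRec f n g)
  then show ?case using stages_PrimRec by blast
next
  case (arity_Mu f n)
  then show ?case using stages_Mu by blast
qed

section \<open>Partial recursive functions on strings\<close>

lemma partial_recursive_comp:
  assumes V: "partial_recursive V" and G: "total_rec 1 G" "\<And>p. G [code p] = code (h p)"
  shows "partial_recursive (\<lambda>p. V (h p))"
proof -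
  obtain f where f: "has_arity f 1" "\<forall>p s. V p = Some s \<longleftrightarrow> evaluates f [code p] (code s)"
    using V unfolding partial_recursive_def by blast
  obtain g where g: "has_arity g 1" "\<And>xs y. length xs = 1 \<Longrightarrow> evaluates g xs y \<longleftrightarrow> y = G xs"
    using total_recE[OF G(1)] by metis
  have "evaluates (Comp f [g]) [code p] y \<longleftrightarrow> evaluates f [code (h p)] y" for p y
    using g(2)[of "[code p]"] G(2)
    by (auto intro!: eval_Comp[of _ _ "[code (h p)]"] elim!: evaluates_CompE
        simp: list_all2_Cons1)
  moreover have "has_arity (Comp f [g]) 1" using f(1) g(1) by (intro arity_Comp) auto
  ultimately show ?thesis using f(2) unfolding partial_recursive_def by auto
qed

text \<open>\<open>Comp\<close> is defined only where all its arguments are, so projecting the pair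
  of values onto the first lets \<open>V\<close> act purely as a domain test.\<close>

lemma partial_recursive_restrict:
  assumes U: "partial_recursive U" and V: "partial_recursive V"
  shows "partial_recursive (U |` dom V)"
proof -
  obtain f where f: "has_arity f 1" "\<forall>p s. U p = Some s \<longleftrightarrow> evaluates f [code p] (code s)"
    using U unfolding partial_recursive_def by blast
  obtain g where g: "has_arity g 1" "\<forall>p s. V p = Some s \<longleftrightarrow> evaluates g [code p] (code s)"
    using V unfolding partial_recursive_def by blast
  have surj: "\<exists>s. y = code s" for y using bij_code by (metis bij_pointE)
  have "evaluates (Comp (Proj 0) [f, g]) [code p] y \<longleftrightarrow>
      evaluates f [code p] y \<and> (\<exists>z. evaluates g [code p] z)" for p y
  proof
    assume "evaluates f [code p] y \<and> (\<exists>z. evaluates g [code p] z)"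
    then obtain z where "evaluates f [code p] y" "evaluates g [code p] z" by blast
    then show "evaluates (Comp (Proj 0) [f, g]) [code p] y"
      using eval_Proj[of 0 "[y, z]"] by (intro eval_Comp[of _ _ "[y, z]"]) auto
  qed (auto elim!: evaluates_CompE evaluates_ProjE simp: list_all2_Cons1)
  moreover have "(\<exists>z. evaluates g [code p] z) \<longleftrightarrow> p \<in> dom V" for p
    using g(2) surj by (metis domD domI)
  moreover have "has_arity (Comp (Proj 0) [f, g]) 1"
    using f(1) g(1) by (intro arity_Comp arity_Proj) auto
  ultimately show ?thesis
    using f(2) unfolding partial_recursive_def
    by (intro exI[of _ "Comp (Proj 0) [f, g]"]) (auto simp: restrict_map_def)
qed

lemma partial_recursive_Some: "partial_recursive Some"
  unfolding partial_recursive_def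
proof (intro exI[of _ "Proj 0"] conjI allI arity_Proj)
  fix p s
  have "evaluates (Proj 0) [code p] y \<longleftrightarrow> y = code p" for y
    using eval_Proj[of 0 "[code p]"] by (auto elim: evaluates_ProjE)
  then show "Some p = Some s \<longleftrightarrow> evaluates (Proj 0) [code p] (code s)"
    using bij_code by (auto simp: bij_def inj_eq)
qed simp

lemma partial_recursive_singleton: "partial_recursive [[] \<mapsto> s]"
proof -
  have nil: "partial_recursive [[] \<mapsto> []]"
    unfolding partial_recursive_def
  \<comment> \<open>On input \<open>x\<close> the minimisation tests \<open>x\<close> itself for
    every \<open>m\<close>, so it stops at once with 0 if \<open>x = 0\<close> and diverges
    otherwise.\<close>
  proof (intro exI[of _ "Mu (Proj 1)"] conjI allI)
    show "has_arity (Mu (Proj 1)) 1" by (intro arity_Mu arity_Proj) simp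
    fix p t
    have *: "evaluates (Proj 1) [m, x] y \<longleftrightarrow> y = x" for m x y
      using eval_Proj[of 1 "[m, x]"] by (auto elim: evaluates_ProjE)
    have "evaluates (Mu (Proj 1)) [x] y \<longleftrightarrow> x = 0 \<and> y = 0" for x y
      using eval_Mu[of "Proj 1" y "[x]"] by (auto elim!: evaluates_MuE simp: *[unfolded One_nat_def])
    moreover have "code q = 0 \<longleftrightarrow> q = []" for q by (cases q) auto
    ultimately show "[[] \<mapsto> []] p = Some t \<longleftrightarrow> evaluates (Mu (Proj 1)) [code p] (code t)"
      by auto
  qed
  have "partial_recursive (\<lambda>p. Some s)"
    using partial_recursive_comp[OF partial_recursive_Some total_rec_const[of 1 "code s"]] by simp
  from partial_recursive_restrict[OF this nil] show ?thesis
    by (rule back_subst[of partial_recursive]) (auto simp: restrict_map_def fun_eq_iff)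
qed

section \<open>First consequences of optimality\<close>

lemma optimalE:
  assumes "optimal V" "prefix_free_machine C"
  obtains d where "\<And>p. p \<in> dom C \<Longrightarrow> \<exists>q. V q = C p \<and> length q \<le> length p + d"
proof -
  have "\<exists>d. \<forall>p\<in>dom C. \<exists>q. V q = C p \<and> length q \<le> length p + d"
    using assms unfolding optimal_def by simp
  with that show ?thesis by blast
qed

lemma optimal_surj:
  assumes "optimal V"
  shows "\<exists>p. V p = Some s"
proof -
  have "prefix_free_machine [[] \<mapsto> s]"
    unfolding prefix_free_machine_def prefix_free_def
    using partial_recursive_singleton by (simp split: if_splits)
  from optimalE[OF assms this] show ?thesis by fastforce
qed

lemma infinite_dom:
  assumes "optimal V"
  shows "infinite (dom V)"
proof
  assume "finite (dom V)"
  then have "finite (ran V)" by (simp add: finite_ran)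
  moreover have "ran V = UNIV" using optimal_surj[OF assms] by (auto simp: ran_def)
  ultimately show False by (simp add: infinite_UNIV_listI)
qed

section \<open>Lengths and concatenation in terms of codes\<close>

lemma length_le_code: "length p \<le> code p"
  by (induction p) auto

text \<open>The strings of length \<open>n\<close> have the codes from \<open>2 ^ n - 1\<close> to
  \<open>2 ^ (n + 1) - 2\<close>, so lengths can be compared by arithmetic on codes.\<close>

lemma code_bounds: "2 ^ length p \<le> Suc (code p)" "Suc (code p) < 2 * 2 ^ length p"
  by (induction p) auto

text \<open>The least significant digit comes first, so a prefix supplies the low-order digits. For
  a fixed prefix \<open>r\<close> this is an affine map on codes.\<close>

lemma code_append: "code (p @ q) = 2 ^ length p * code q + code p"
  by (induction p) (auto simp: algebra_simps)

section \<open>Optimal machines are not injective\<close>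

text \<open>Since \<open>dom V\<close> is infinite, there are halting programs with arbitrarily
  large codes, and stages make the search for one effective. The bound \<open>b\<close> is stated on
  codes to keep it arithmetical.\<close>

lemma search_computable:
  assumes V: "partial_recursive V" and inf: "infinite (dom V)" and B: "total_rec 1 (\<lambda>xs. b (xs ! 0))"
  obtains G g where "total_rec 1 G" "\<And>p. G [code p] = code (g p)"
    "\<And>p. g p \<in> dom V" "\<And>p. code (g p) \<ge> b (code p)"
proof -
  obtain f where f: "has_arity f 1" "\<forall>p s. V p = Some s \<longleftrightarrow> evaluates f [code p] (code s)"
    using V unfolding partial_recursive_def by blast
  obtain F where F: "stages 1 f F" using stages_exist[OF f(1)] by blast
  have surj: "\<exists>s. y = code s" for y using bij_code by (metis bij_pointE)
  have dom: "p \<in> dom V \<longleftrightarrow> (\<exists>t. F [t, code p] > 0)" for p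
  proof -
    have "p \<in> dom V \<longleftrightarrow> (\<exists>y. evaluates f [code p] y)" using f(2) surj by (metis domD domI)
    then show ?thesis
      using stages_evaluates[OF F, of "[code p]"] by (auto simp: gr0_conv_Suc)
  qed
  define A where "A t x r \<longleftrightarrow> F [t, r] \<ge> 1 \<and> b x \<le> r" for t x r
  text \<open>\<open>M\<close> tests all candidates below \<open>t\<close> by stage \<open>t\<close>, so one search for \<open>t\<close> dovetails over all programs.\<close>
  define M where "M t x = (LEAST r. A t x r \<or> r = t)" for t x
  define T where "T x = (LEAST t. A t x (M t x))" for x
  have A: "decidable n (\<lambda>xs. A (t xs) (x xs) (r xs))"
    if "total_rec n t" "total_rec n x" "total_rec n r" for n t x r
  proof -
    have "total_rec n (\<lambda>xs. F [t xs, r xs])"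
    proof (rule total_rec_subst[where k = 2 and F = F])
      show "total_rec 2 F" using F by (simp add: stages_def numeral_2_eq_2)
      show "total_rec n (\<lambda>xs. [t xs, r xs] ! i)" if "i < 2" for i
        using that \<open>total_rec n t\<close> \<open>total_rec n r\<close> by (auto simp: less_2_cases_iff)
    qed simp
    then show ?thesis
      unfolding A_def using that
      by (intro decidable_conj decidable_le total_rec_const total_rec_comp1[OF B]) auto
  qed
  have M: "total_rec 2 (\<lambda>xs. M (xs ! 0) (xs ! 1))"
  proof -
    have "decidable (Suc 2) (\<lambda>zs. A (zs ! 1) (zs ! 2) (zs ! 0) \<or> zs ! 0 = zs ! 1)"
      by (intro decidable_disj A decidable_eq total_rec_nth) auto
    from total_rec_Least[OF this] show ?thesis unfolding M_def by auto
  qed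
  have ex: "\<exists>t. A t x (M t x)" for x
  proof -
    have "finite {p. code p < b x}"
      using finite_vimageI[of "{..<b x}" code] bij_code by (simp add: bij_def vimage_def)
    then have "\<not> dom V \<subseteq> {p. code p < b x}" using inf finite_subset by blast
    then obtain p where p: "p \<in> dom V" "b x \<le> code p" by fastforce
    then obtain t y where t: "F [t, code p] = Suc y" using dom by (metis gr0_conv_Suc)
    \<comment> \<open>Being above \<open>code p\<close>, this stage separates a genuine hit from the
      fallback \<open>r = t\<close> in \<open>M\<close>.\<close>
    define u where "u = max t (Suc (code p))"
    have "F [u, code p] = Suc y"
      using stages_mono[OF F _ _ t, of u] unfolding u_def by simp
    then have Ap: "A u x (code p)" unfolding A_def using p by simp
    then have "M u x \<le> code p" unfolding M_def by (intro Least_le) simp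
    moreover have "A u x (M u x) \<or> M u x = u"
      unfolding M_def by (rule LeastI[of _ u]) simp
    ultimately have "A u x (M u x)" unfolding u_def by linarith
    then show ?thesis by blast
  qed
  have T: "A (T x) x (M (T x) x)" for x unfolding T_def using LeastI_ex[OF ex] .
  have T_rec: "total_rec 1 (\<lambda>xs. T (xs ! 0))"
  proof -
    have "decidable (Suc 1) (\<lambda>zs. A (zs ! 0) (zs ! 1) (M (zs ! 0) (zs ! 1)))"
      using M by (intro A total_rec_nth) (auto simp: numeral_2_eq_2)
    from total_rec_Least[OF this] show ?thesis unfolding T_def using ex by auto
  qed
  define g where "g p = inv code (M (T (code p)) (code p))" for p
  have g: "code (g p) = M (T (code p)) (code p)" for p
    unfolding g_def using bij_code by (simp add: bij_is_surj surj_f_inv_f)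
  show ?thesis
  proof (rule that)
    show "total_rec 1 (\<lambda>xs. M (T (xs ! 0)) (xs ! 0))"
      by (intro total_rec_comp2[OF M] T_rec total_rec_nth) simp
    show "M (T ([code p] ! 0)) ([code p] ! 0) = code (g p)" for p by (simp add: g)
    show "g p \<in> dom V" "code (g p) \<ge> b (code p)" for p
      using T[of "code p"] dom[of "g p"] unfolding g[symmetric] A_def by (auto simp: Suc_le_eq)
  qed
qed

text \<open>The conclusion records which of the two programs is at least as long, because that is
  the one to be given up.\<close>

lemma optimal_not_injective:
  assumes V: "optimal V"
  obtains p q where "p \<noteq> q" "p \<in> dom V" "V p = V q" "length q \<le> length p"
proof -
  have rec: "partial_recursive V" and pf: "prefix_free (dom V)"
    using V unfolding optimal_def prefix_free_machine_def by auto
  have inf: "infinite (dom V)" using infinite_dom[OF V] .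
  \<comment> \<open>Squaring doubles the length, and the factor 2 absorbs the slack between the two
    bounds in \<open>code_bounds\<close>, so \<open>g p\<close> becomes more than twice as long as
    \<open>p\<close>.\<close>
  have "total_rec 1 (\<lambda>xs. 2 * (Suc (xs ! 0) * Suc (xs ! 0)))"
    by (intro total_rec_mult total_rec_const total_rec_Suc total_rec_nth) auto
  from search_computable[OF rec inf, where b = "\<lambda>x. 2 * (Suc x * Suc x)", OF this]
  obtain G g where G: "total_rec 1 G" "\<And>p. G [code p] = code (g p)"
    and g: "\<And>p. g p \<in> dom V" "\<And>p. code (g p) \<ge> 2 * (Suc (code p) * Suc (code p))"
    by metis
  define C where "C = (\<lambda>p. V (g p)) |` dom V"
  have "dom C = dom V" unfolding C_def using g(1) by auto
  moreover have "partial_recursive C"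
    unfolding C_def by (intro partial_recursive_restrict partial_recursive_comp[OF rec G] rec)
  ultimately have "prefix_free_machine C" using pf unfolding prefix_free_machine_def by simp
  then obtain d where d: "\<And>p. p \<in> dom C \<Longrightarrow> \<exists>q. V q = C p \<and> length q \<le> length p + d"
    using optimalE[OF V] by metis
  \<comment> \<open>Only finitely many strings have length at most \<open>d\<close>, so some halting
    \<open>p\<close> is longer; then \<open>length p + d\<close> is below twice
    \<open>length p\<close>, hence below \<open>length (g p)\<close>.\<close>
  have "\<not> dom V \<subseteq> {p. set p \<subseteq> UNIV \<and> length p \<le> d}"
    using inf finite_subset finite_lists_length_le[OF finite_UNIV, of d] by metis
  then obtain p where p: "p \<in> dom V" "d < length p"
    by (metis (mono_tags) CollectI linorder_not_le subsetI subset_UNIV)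
  have "C p = V (g p)" using p(1) by (simp add: C_def)
  with d[of p] p(1) \<open>dom C = dom V\<close> obtain q where q: "V q = V (g p)" "length q \<le> length p + d"
    by metis
  have "2 * 2 ^ (length p + length p) \<le> 2 * (Suc (code p) * Suc (code p))"
    unfolding power_add using code_bounds(1) by (intro mult_le_mono) auto
  also have "\<dots> < 2 * 2 ^ length (g p)"
    using g(2)[of p] code_bounds(2)[of "g p"] by linarith
  finally have "length p + length p < length (g p)" by simp
  with p(2) q(2) have "length q < length (g p)" by simp
  with q(1) g(1) show ?thesis by (intro that[of "g p" q]) auto
qed

section \<open>Redirecting a superfluous description\<close>

text \<open>An empty \<open>r\<close> could be removed forever, hence the guard.\<close>

function strip :: "'a list \<Rightarrow> 'a list \<Rightarrow> 'a list" where
  "strip r p = (if r \<noteq> [] \<and> prefix r p then strip r (drop (length r) p) else p)"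
  by auto
termination
  by (relation "measure (\<lambda>(r, p). length p)") (auto simp: prefix_def)

declare strip.simps [simp del]

lemma strip_append: "r \<noteq> [] \<Longrightarrow> strip r (r @ p) = strip r p"
  by (subst strip.simps) simp

lemma strip_id: "\<not> (r \<noteq> [] \<and> prefix r p) \<Longrightarrow> strip r p = p"
  by (subst strip.simps) (rule if_not_P)

lemma strip_replicate: "r \<noteq> [] \<Longrightarrow> strip r (concat (replicate k r) @ p) = strip r p"
  by (induction k) (auto simp: strip_append)

lemma length_strip: "length (strip r p) \<le> length p"
proof (induction r p rule: strip.induct)
  case (1 r p)
  then show ?case by (subst strip.simps) (auto intro: order_trans)
qed

text \<open>Both strings lose leading copies of \<open>r\<close> together until \<open>p\<close> no
  longer starts with \<open>r\<close>. If \<open>q\<close> still did, \<open>p\<close> and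
  \<open>r\<close> would be comparable elements of \<open>S\<close>, hence equal, which is
  impossible.\<close>

lemma strip_prefix_free:
  assumes S: "prefix_free S"
  shows "r \<in> S \<Longrightarrow> strip r p \<in> S \<Longrightarrow> strip r q \<in> S \<Longrightarrow> prefix p q \<Longrightarrow> p = q"
proof (induction r p arbitrary: q rule: strip.induct)
  case (1 r p)
  have eq: "x = y" if "x \<in> S" "y \<in> S" "prefix x y" for x y
    using S that unfolding prefix_free_def by blast
  show ?case
  proof (cases "r \<noteq> [] \<and> prefix r p")
    case True
    then have "prefix r q" using "1.prems"(4) prefix_order.trans by metis
    then obtain p' q' where p': "p = r @ p'" and q': "q = r @ q'"
      using True unfolding prefix_def by blast
    have "p' = q'"
      using "1.IH"[OF True, of q'] "1.prems" True by (simp add: p' q' strip_append)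
    then show ?thesis by (simp add: p' q')
  next
    case False
    have p: "p \<in> S" using "1.prems"(2) unfolding strip_id[OF False] .
    have q: "\<not> (r \<noteq> [] \<and> prefix r q)"
    proof
      assume "r \<noteq> [] \<and> prefix r q"
      then have "prefix p r \<or> prefix r p" using "1.prems"(4) prefix_same_cases by metis
      then have "p = r" using eq[OF p "1.prems"(1)] eq[OF "1.prems"(1) p] by metis
      with False \<open>r \<noteq> [] \<and> prefix r q\<close> show False by simp
    qed
    have "q \<in> S" using "1.prems"(3) unfolding strip_id[OF q] .
    from eq[OF p this "1.prems"(4)] show ?thesis .
  qed
qed

text \<open>One removal of \<open>r\<close> inverts the affine map of \<open>code_append\<close> by
  a search that is bounded by the input; this step is then iterated often enough.\<close>

lemma strip_computable:
  assumes "r \<noteq> []"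
  obtains G where "total_rec 1 G" "\<And>p. G [code p] = code (strip r p)"
proof -
  define step where "step p = (if prefix r p then drop (length r) p else p)" for p
  text \<open>The alternative \<open>m = n\<close> makes the search total; it stops there only if \<open>r\<close> is no prefix.\<close>
  define h where "h n = (LEAST m. 2 ^ length r * m + code r = n \<or> m = n)" for n
  have h: "h (code p) = code (step p)" for p
  proof (cases "prefix r p")
    case True
    then obtain q where q: "p = r @ q" unfolding prefix_def by blast
    have "h (code p) = code q"
      unfolding h_def
    proof (rule Least_equality)
      fix m assume "2 ^ length r * m + code r = code p \<or> m = code p"
      then show "code q \<le> m"
      proof
        assume "m = code p"
        have "code q \<le> 2 ^ length r * code q" by simp
        with \<open>m = code p\<close> show ?thesis unfolding q code_append by linarith
      qed (simp add: q code_append)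
    qed (simp add: q code_append)
    with q show ?thesis by (simp add: step_def)
  next
    case False
    \<comment> \<open>Every number is a code, so a solution \<open>m\<close> would be the code of
      some \<open>q\<close> with \<open>p = r @ q\<close>.\<close>
    have "2 ^ length r * m + code r \<noteq> code p" for m
    proof
      assume *: "2 ^ length r * m + code r = code p"
      obtain q where "m = code q" using bij_code by (metis bij_pointE)
      with * have "code p = code (r @ q)" by (simp add: code_append)
      then have "p = r @ q" using bij_code by (simp add: bij_def inj_eq)
      with False show False by simp
    qed
    with False show ?thesis by (auto simp: h_def step_def intro!: Least_equality)
  qed
  have "decidable (Suc 1) (\<lambda>zs. 2 ^ length r * zs ! 0 + code r = zs ! 1 \<or> zs ! 0 = zs ! 1)"
    by (intro decidable_disj decidable_eq total_rec_add total_rec_mult total_rec_const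
        total_rec_nth) auto
  from total_rec_Least[OF this] have "total_rec 1 (\<lambda>xs. h (xs ! 0))"
    unfolding h_def by auto
  then have "total_rec 1 (\<lambda>xs. (h ^^ (xs ! 0)) (xs ! 0))"
    by (intro total_rec_funpow total_rec_nth) auto
  moreover have "(h ^^ n) (code p) = code ((step ^^ n) p)" for n p
    by (induction n) (simp_all add: h)
  moreover have "(step ^^ n) p = strip r p" if "length p \<le> n" for n p
    using that
  proof (induction n arbitrary: p)
    case 0
    with assms show ?case by (simp add: strip_id)
  next
    case (Suc n)
    show ?case
    proof (cases "prefix r p")
      case True
      then obtain q where q: "p = r @ q" unfolding prefix_def by blast
      have "length r > 0" using assms by simp
      with Suc.prems q have "length q \<le> n" by (simp del: length_greater_0_conv)
      then show ?thesis
        using Suc.IH assms by (simp add: q funpow_Suc_right step_def strip_append del: funpow.simps)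
    next
      case False
      then have "(step ^^ k) p = p" for k by (induction k) (simp_all add: step_def)
      with False show ?thesis by (simp add: strip_id del: funpow.simps)
    qed
  qed
  ultimately show ?thesis
    by (intro that[of "\<lambda>xs. (h ^^ (xs ! 0)) (xs ! 0)"]) (auto simp: length_le_code)
qed

theorem theorem9:
  fixes V :: "bool list \<rightharpoonup> bool list"
  assumes "optimal V"
  shows "\<exists>W. optimal W \<and>
           (\<forall>s. complexity W s = complexity V s) \<and>
           (\<forall>s. infinite (W -` {Some s}))"
proof -
  have rec: "partial_recursive V" and pf: "prefix_free (dom V)"
    using assms unfolding optimal_def prefix_free_machine_def by auto
  \<comment> \<open>\<open>r\<close> is the program to be given up, and \<open>r'\<close> keeps its
    output available at no greater length.\<close>
  obtain r r' where r: "r' \<noteq> r" "r \<in> dom V" "V r = V r'" "length r' \<le> length r"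
    using optimal_not_injective[OF assms] by metis
  then have r': "r' \<in> dom V" by (metis domIff)
  have eq: "p = q" if "p \<in> dom V" "q \<in> dom V" "prefix p q" for p q
    using pf that unfolding prefix_free_def by blast
  \<comment> \<open>The empty string would be a prefix of \<open>r'\<close>, contrary to
    prefix-freeness.\<close>
  have "r \<noteq> []" using eq[OF r(2) r'] r(1) by auto
  \<comment> \<open>A program of \<open>V\<close> other than \<open>r\<close> cannot begin with
    \<open>r\<close>, so \<open>W\<close> treats it as \<open>V\<close> does.\<close>
  have strip_dom: "strip r q = q" if "q \<in> dom V" "q \<noteq> r" for q
    using eq[OF r(2) that(1)] that(2) by (intro strip_id) auto
  define W where "W = (\<lambda>p. V (strip r p))"
  have short: "\<exists>q'. q' \<noteq> r \<and> V q' = Some s \<and> length q' \<le> length q" if "V q = Some s" for q s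
    using that r by (cases "q = r") (metis, blast)
  have VW: "\<exists>q'. W q' = Some s \<and> length q' \<le> length q" if "V q = Some s" for q s
    using short[OF that] strip_dom unfolding W_def by (metis domI)
  \<comment> \<open>Stripping never lengthens a string, so \<open>W\<close> gains no program shorter
    than those of \<open>V\<close>.\<close>
  have WV: "\<exists>q'. V q' = Some s \<and> length q' \<le> length q" if "W q = Some s" for q s
    using that length_strip unfolding W_def by blast
  have "partial_recursive W"
    unfolding W_def using strip_computable[OF \<open>r \<noteq> []\<close>] partial_recursive_comp[OF rec] by metis
  moreover have "prefix_free (dom W)"
    unfolding prefix_free_def W_def using strip_prefix_free[OF pf r(2)] by blast
  ultimately have pfm: "prefix_free_machine W" unfolding prefix_free_machine_def by simp
  have "optimal W"
    unfolding optimal_def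
  proof (intro conjI allI impI pfm)
    fix C assume "prefix_free_machine C"
    then obtain d where d: "\<And>p. p \<in> dom C \<Longrightarrow> \<exists>q. V q = C p \<and> length q \<le> length p + d"
      using optimalE[OF assms] by metis
    have "\<exists>q. W q = C p \<and> length q \<le> length p + d" if "p \<in> dom C" for p
      using d that VW by (metis domD order_trans)
    then show "\<exists>d. \<forall>p\<in>dom C. \<exists>q. W q = C p \<and> length q \<le> length p + d" by blast
  qed
  moreover have "complexity W s = complexity V s" for s
    unfolding complexity_def
    by (intro antisym Inf_mono) (use VW WV in \<open>force+\<close>)
  moreover have "infinite (W -` {Some s})" for s
  proof -
    obtain q where q: "q \<noteq> r" "V q = Some s"
      using optimal_surj[OF assms] short by metis
    \<comment> \<open>As \<open>q\<close> is a program other than \<open>r\<close>, stripping the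
      copies of \<open>r\<close> leaves exactly \<open>q\<close>; the lengths differ because
      \<open>r\<close> is nonempty.\<close>
    define c where "c k = concat (replicate k r) @ q" for k
    have "length (c k) = k * length r + length q" for k
      by (induction k) (simp_all add: c_def)
    then have "inj c"
      using \<open>r \<noteq> []\<close> by (intro injI) (metis add_right_cancel length_0_conv mult_right_cancel)
    moreover have "range c \<subseteq> W -` {Some s}"
      using q strip_dom[OF domI] \<open>r \<noteq> []\<close> by (auto simp: c_def W_def strip_replicate)
    ultimately show ?thesis using finite_subset range_inj_infinite by blast
  qed
  ultimately show ?thesis by blast
qed

end
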